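(* Consider the linear regression model $Y=\beta'\mathbf{x}+\varepsilon$, where $\beta\in\mathbb{R}^p$ is an unknown parameter vector, $\mathbf{x}$ is a $p$-dimensional covariate with a certain (single, classical) distribution $F_{\mathbf{x}}$, and the error $\varepsilon$, independent of $\mathbf{x}$, is defined on a sublinear expectation space $(\Omega,\mathcal{H},\mathbb{E})$. Suppose that $\varepsilon$ is $G$-normally distributed, $\varepsilon\sim N(\{0\}\times[\underline{\sigma}^2,\overline{\sigma}^2])$. (1) The $G$-expectation of $Y$ is identifiable in the sense that $\mathbb{E}[Y|\mathbf{x}]$ is uniquely determined by $\beta'\mathbf{x}$: $$\mathbb{E}[Y|\mathbf{x}]=\beta'\mathbf{x}.$$ (2) If in addition $E[\mathbf{x}\mathbf{x}']$ is a positive definite matrix, then $\beta$ is identifiable in the sense that it is uniquely determined as $$\beta=(E[\mathbf{x}\mathbf{x}'])^{-1}E\{\mathbf{x}\,\mathbb{E}[Y|\mathbf{x}]\},$$ where the linear expectation $E$ is taken under the distribution $F_{\mathbf{x}}$.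
   Context: A prime denotes transpose. Let $\Omega$ be a set and $\mathcal{H}$ a linear space of real-valued functions on $\Omega$. A sublinear expectation is a map $\mathbb{E}:\mathcal{H}\to\mathbb{R}$ such that for all $U,V\in\mathcal{H}$: (i) $U\ge V$ implies $\mathbb{E}[U]\ge\mathbb{E}[V]$; (ii) $\mathbb{E}[c]=c$ for constants $c$; (iii) $\mathbb{E}[U+V]\le\mathbb{E}[U]+\mathbb{E}[V]$; (iv) $\mathbb{E}[\lambda U]=\lambda\mathbb{E}[U]$ for $\lambda\ge0$. The triple $(\Omega,\mathcal{H},\mathbb{E})$ is a sublinear expectation space. It is assumed that $\mathcal{H}$ contains linear and quadratic functions of $\varepsilon$. The conditional sublinear expectation is defined by $\mathbb{E}[Y|\mathbf{x}]=\sup_{f_{Y|\mathbf{x}}\in\mathcal{F}_{Y|\mathbf{x}}}E_{f_{Y|\mathbf{x}}}[Y|\mathbf{x}]$, where $\{E_{f_{Y|\mathbf{x}}}\}$ is a family of conditional linear expectations. It satisfies properties (i)-(iv) conditionally on $\mathbf{x}$, with $\mathbf{x}$ treated as fixed (constant) under the conditioning. Since $\varepsilon$ is independent of $\mathbf{x}$, $\mathbb{E}[\varepsilon|\mathbf{x}]=\mathbb{E}[\varepsilon]$. $G$-normality: $\varepsilon$ is $G$-normally distributed if for all $a,b\ge0$, $a\varepsilon+b\bar\varepsilon\overset{d}{=}\sqrt{a^2+b^2}\,\varepsilon$, where $\bar\varepsilon$ is an independent copy of $\varepsilon$. Here $X\overset{d}{=}Z$ means $\mathbb{E}[\varphi(X)]=\mathbb{E}[\varphi(Z)]$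 for all test functions $\varphi$ (locally Lipschitz with polynomial growth). "Independent copy" means $\bar\varepsilon\overset{d}{=}\varepsilon$ and $\mathbb{E}[\varphi(\varepsilon,\bar\varepsilon)]=\mathbb{E}[\mathbb{E}[\varphi(u,\bar\varepsilon)]_{u=\varepsilon}]$ for all test functions $\varphi$. The notation $N(\{0\}\times[\underline{\sigma}^2,\overline{\sigma}^2])$ indicates certain zero mean, $\mathbb{E}[\varepsilon]=-\mathbb{E}[-\varepsilon]=0$, with $\overline\sigma^2=\mathbb{E}[\varepsilon^2]$ and $\underline\sigma^2=-\mathbb{E}[-\varepsilon^2]$. *)

theory Defs
  imports "HOL-Probability.Probability"
begin

text \<open>
  The set \<open>\<Omega>\<close> is the universe of the type \<open>'w\<close>.  Expectations are total HOL functions on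
  \<open>'w \<Rightarrow> real\<close>, but they are constrained only on the given linear space of variables.
\<close>

definition linear_space :: "('w \<Rightarrow> real) set \<Rightarrow> bool" where
  "linear_space H \<longleftrightarrow> (\<lambda>_. 0) \<in> H
     \<and> (\<forall>U\<in>H. \<forall>V\<in>H. (\<lambda>\<omega>. U \<omega> + V \<omega>) \<in> H)
     \<and> (\<forall>U\<in>H. \<forall>c. (\<lambda>\<omega>. c * U \<omega>) \<in> H)"

definition sublinear_expectation_space ::
    "('w \<Rightarrow> real) set \<Rightarrow> (('w \<Rightarrow> real) \<Rightarrow> real) \<Rightarrow> bool" where
  "sublinear_expectation_space H E \<longleftrightarrow> linear_space H \<and> (\<forall>c. (\<lambda>_. c) \<in> H)
     \<and> (\<forall>U\<in>H. \<forall>V\<in>H. (\<forall>\<omega>. V \<omega> \<le> U \<omega>) \<longrightarrow> E V \<le> E U)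
     \<and> (\<forall>c. E (\<lambda>_. c) = c)
     \<and> (\<forall>U\<in>H. \<forall>V\<in>H. E (\<lambda>\<omega>. U \<omega> + V \<omega>) \<le> E U + E V)
     \<and> (\<forall>U\<in>H. \<forall>c\<ge>0. E (\<lambda>\<omega>. c * U \<omega>) = c * E U)"

definition linear_expectation ::
    "('w \<Rightarrow> real) set \<Rightarrow> (('w \<Rightarrow> real) \<Rightarrow> real) \<Rightarrow> bool" where
  "linear_expectation D L \<longleftrightarrow>
       (\<forall>U\<in>D. \<forall>V\<in>D. (\<forall>\<omega>. V \<omega> \<le> U \<omega>) \<longrightarrow> L V \<le> L U)
     \<and> (\<forall>c. L (\<lambda>_. c) = c)
     \<and> (\<forall>U\<in>D. \<forall>V\<in>D. L (\<lambda>\<omega>. U \<omega> + V \<omega>) = L U + L V)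
     \<and> (\<forall>U\<in>D. \<forall>c. L (\<lambda>\<omega>. c * U \<omega>) = c * L U)"


text \<open>
  Peng's class of locally Lipschitz functions with polynomial growth: the local Lipschitz
  constant grows at most polynomially, which also bounds the growth of the function.
\<close>

definition test_function :: "('a::real_normed_vector \<Rightarrow> real) \<Rightarrow> bool" where
  "test_function \<phi> \<longleftrightarrow> (\<exists>C. \<exists>m::nat. \<forall>u v.
     \<bar>\<phi> u - \<phi> v\<bar> \<le> C * (1 + norm u ^ m + norm v ^ m) * norm (u - v))"

definition test_variable :: "('w \<Rightarrow> real) set \<Rightarrow> ('w \<Rightarrow> 'a::real_normed_vector) \<Rightarrow> bool" where
  "test_variable H X \<longleftrightarrow> (\<forall>\<phi>. test_function \<phi> \<longrightarrow> (\<lambda>\<omega>. \<phi> (X \<omega>)) \<in> H)"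

definition eq_dist :: "('w \<Rightarrow> real) set \<Rightarrow> (('w \<Rightarrow> real) \<Rightarrow> real)
    \<Rightarrow> ('w \<Rightarrow> 'a::real_normed_vector) \<Rightarrow> ('w \<Rightarrow> 'a) \<Rightarrow> bool" where
  "eq_dist H E X Z \<longleftrightarrow> test_variable H X \<and> test_variable H Z
     \<and> (\<forall>\<phi>. test_function \<phi> \<longrightarrow> E (\<lambda>\<omega>. \<phi> (X \<omega>)) = E (\<lambda>\<omega>. \<phi> (Z \<omega>)))"

definition independent_copy :: "('w \<Rightarrow> real) set \<Rightarrow> (('w \<Rightarrow> real) \<Rightarrow> real)
    \<Rightarrow> ('w \<Rightarrow> real) \<Rightarrow> ('w \<Rightarrow> real) \<Rightarrow> bool" where
  "independent_copy H E X Z \<longleftrightarrow> eq_dist H E Z X \<and> test_variable H (\<lambda>\<omega>. (X \<omega>, Z \<omega>))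
     \<and> (\<forall>\<phi> :: real \<times> real \<Rightarrow> real. test_function \<phi> \<longrightarrow>
          E (\<lambda>\<omega>. \<phi> (X \<omega>, Z \<omega>)) = E (\<lambda>\<omega>. E (\<lambda>\<omega>'. \<phi> (X \<omega>, Z \<omega>'))))"

definition G_normal :: "('w \<Rightarrow> real) set \<Rightarrow> (('w \<Rightarrow> real) \<Rightarrow> real) \<Rightarrow> ('w \<Rightarrow> real) \<Rightarrow> bool" where
  "G_normal H E X \<longleftrightarrow> (\<exists>Z. independent_copy H E X Z
     \<and> (\<forall>a\<ge>0. \<forall>b\<ge>0. eq_dist H E (\<lambda>\<omega>. a * X \<omega> + b * Z \<omega>) (\<lambda>\<omega>. sqrt (a\<^sup>2 + b\<^sup>2) * X \<omega>)))"

text \<open>The parameters \<open>sl\<close>, \<open>su\<close> are the lower and upper standard deviations.\<close>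

definition G_normal_dist :: "('w \<Rightarrow> real) set \<Rightarrow> (('w \<Rightarrow> real) \<Rightarrow> real)
    \<Rightarrow> ('w \<Rightarrow> real) \<Rightarrow> real \<Rightarrow> real \<Rightarrow> bool" where
  "G_normal_dist H E X sl su \<longleftrightarrow> G_normal H E X
     \<and> E X = 0 \<and> - E (\<lambda>\<omega>. - X \<omega>) = 0
     \<and> su\<^sup>2 = E (\<lambda>\<omega>. (X \<omega>)\<^sup>2) \<and> sl\<^sup>2 = - E (\<lambda>\<omega>. - (X \<omega>)\<^sup>2)"


text \<open>
  The covariate has a single classical law: \<open>x\<close> is a random vector on a probability space
  \<open>P\<close> over \<open>\<Omega>\<close> with distribution \<open>F\<close>, and \<open>E\<close> restricted to functions of \<open>x\<close> is the
  linear expectation under \<open>F\<close>.  The sigma-algebra of \<open>P\<close> may be as small as the one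
  generated by \<open>x\<close>, so \<open>P\<close> need not measure the error.  The law is tested on bounded
  Lipschitz functions, because functions of polynomial growth would force all moments of
  \<open>F\<close> to exist.  Classical expectations under \<open>F\<close> of functions of \<open>x\<close> are written as
  integrals over \<open>P\<close>, which agree with those over \<open>F\<close> by change of variables.
\<close>

definition certain_distribution :: "('w \<Rightarrow> real) set \<Rightarrow> (('w \<Rightarrow> real) \<Rightarrow> real)
    \<Rightarrow> 'w measure \<Rightarrow> ('w \<Rightarrow> real ^ 'p) \<Rightarrow> (real ^ 'p) measure \<Rightarrow> bool" where
  "certain_distribution H E P x F \<longleftrightarrow>
       prob_space P \<and> space P = UNIV \<and> x \<in> borel_measurable P \<and> distr P borel x = F
     \<and> (\<forall>\<phi> :: real ^ 'p \<Rightarrow> real. bounded (range \<phi>) \<and> (\<exists>C. C-lipschitz_on UNIV \<phi>) \<longrightarrow>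
          (\<lambda>\<omega>. \<phi> (x \<omega>)) \<in> H \<and> E (\<lambda>\<omega>. \<phi> (x \<omega>)) = (\<integral>\<xi>. \<phi> \<xi> \<partial>F))"


text \<open>
  A conditional linear expectation given \<open>x = \<xi>\<close> treats \<open>x\<close> as the constant \<open>\<xi>\<close>: factors
  that are functions of \<open>x\<close> are pulled out and evaluated at \<open>\<xi>\<close>.
\<close>

definition cond_linear_expectation :: "('w \<Rightarrow> real) set \<Rightarrow> ('w \<Rightarrow> real ^ 'p) \<Rightarrow> real ^ 'p
    \<Rightarrow> (('w \<Rightarrow> real) \<Rightarrow> real) \<Rightarrow> bool" where
  "cond_linear_expectation D x \<xi> L \<longleftrightarrow> linear_expectation D L
     \<and> (\<forall>g\<in>borel_measurable borel. \<forall>U\<in>D. (\<lambda>\<omega>. g (x \<omega>) * U \<omega>) \<in> D \<longrightarrow>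
          L (\<lambda>\<omega>. g (x \<omega>) * U \<omega>) = g \<xi> * L U)"

text \<open>
  \<open>\<F> \<xi>\<close> is the family of conditional linear expectations given \<open>x = \<xi>\<close>, for \<open>\<xi>\<close> in the range
  of \<open>x\<close>.  They act on a linear space \<open>D\<close> that contains \<open>H\<close> and the components of \<open>x\<close>; it may
  be larger than \<open>H\<close>, since under conditioning no moments of \<open>x\<close> are needed.  Nonemptiness
  and boundedness make the supremum a genuine real supremum.
\<close>

definition cond_expectation_family :: "('w \<Rightarrow> real) set \<Rightarrow> ('w \<Rightarrow> real) set
    \<Rightarrow> ('w \<Rightarrow> real ^ 'p) \<Rightarrow> (real ^ 'p \<Rightarrow> (('w \<Rightarrow> real) \<Rightarrow> real) set) \<Rightarrow> bool" where
  "cond_expectation_family H D x \<F> \<longleftrightarrow>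
       linear_space D \<and> H \<subseteq> D \<and> (\<forall>i. (\<lambda>\<omega>. x \<omega> $ i) \<in> D)
     \<and> (\<forall>\<xi>\<in>range x. \<F> \<xi> \<noteq> {} \<and> (\<forall>L\<in>\<F> \<xi>. cond_linear_expectation D x \<xi> L)
          \<and> (\<forall>U\<in>D. bdd_above ((\<lambda>L. L U) ` \<F> \<xi>)))"

text \<open>\<open>E[U | x]\<close>, as a random variable that is a function of \<open>x\<close>.\<close>

definition cond_sublinear_expectation :: "(real ^ 'p \<Rightarrow> (('w \<Rightarrow> real) \<Rightarrow> real) set)
    \<Rightarrow> ('w \<Rightarrow> real ^ 'p) \<Rightarrow> ('w \<Rightarrow> real) \<Rightarrow> 'w \<Rightarrow> real" where
  "cond_sublinear_expectation \<F> x U \<omega> = (SUP L\<in>\<F> (x \<omega>). L U)"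

text \<open>Independence of \<open>X\<close> from \<open>x\<close>: the conditional law of \<open>X\<close> given \<open>x\<close> is its law under \<open>E\<close>.\<close>

definition independent_of_covariate :: "('w \<Rightarrow> real) set \<Rightarrow> (('w \<Rightarrow> real) \<Rightarrow> real)
    \<Rightarrow> (real ^ 'p \<Rightarrow> (('w \<Rightarrow> real) \<Rightarrow> real) set) \<Rightarrow> ('w \<Rightarrow> real ^ 'p) \<Rightarrow> ('w \<Rightarrow> real) \<Rightarrow> bool" where
  "independent_of_covariate H E \<F> x X \<longleftrightarrow> test_variable H X
     \<and> (\<forall>\<phi> :: real \<Rightarrow> real. test_function \<phi> \<longrightarrow>
          (\<forall>\<omega>. cond_sublinear_expectation \<F> x (\<lambda>\<omega>'. \<phi> (X \<omega>')) \<omega> = E (\<lambda>\<omega>'. \<phi> (X \<omega>'))))"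


definition second_moment_matrix :: "'w measure \<Rightarrow> ('w \<Rightarrow> real ^ 'p) \<Rightarrow> real ^ 'p ^ 'p" where
  "second_moment_matrix P x = (\<chi> i j. \<integral>\<omega>. x \<omega> $ i * x \<omega> $ j \<partial>P)"

definition positive_definite :: "real ^ 'n ^ 'n \<Rightarrow> bool" where
  "positive_definite A \<longleftrightarrow> transpose A = A \<and> (\<forall>v. v \<noteq> 0 \<longrightarrow> 0 < v \<bullet> (A *v v))"

end

theory Submission
  imports Defs
begin

text \<open>
  Sublinearity disappears as soon as the mean is certain.  Given \<open>x = \<xi>\<close>, the upper envelope of
  the linear expectations \<open>L\<close> vanishes on both \<open>\<epsilon>\<close> and \<open>-\<epsilon>\<close>, by independence of \<open>\<epsilon>\<close> from \<open>x\<close>.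
  Hence \<open>L \<epsilon> \<le> 0\<close> and \<open>- L \<epsilon> \<le> 0\<close>, so the whole family agrees that \<open>\<epsilon>\<close> has mean zero
  (\<open>certain_zero_mean_under_conditioning\<close>).  As conditioning also freezes \<open>\<beta> \<bullet> x\<close> at \<open>\<beta> \<bullet> \<xi>\<close>,
  every \<open>L\<close> assigns \<open>Y\<close> the same value, and the supremum is over a single number.

  Identifiability of \<open>\<beta>\<close> is then classical least squares: \<open>E[x (\<beta> \<bullet> x)] = E[x x'] \<beta>\<close>, and a
  positive definite matrix has trivial kernel, so \<open>\<beta>\<close> can be recovered by inverting it.
\<close>

lemma linear_expectation_sum_scaled:
  assumes D: "linear_space D" and L: "linear_expectation D L"
    and "finite I" and "\<And>i. i \<in> I \<Longrightarrow> U i \<in> D"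
  shows "(\<lambda>\<omega>. \<Sum>i\<in>I. c i * U i \<omega>) \<in> D
    \<and> L (\<lambda>\<omega>. \<Sum>i\<in>I. c i * U i \<omega>) = (\<Sum>i\<in>I. c i * L (U i))"
  using assms(3,4)
proof (induction I rule: finite_induct)
  case empty
  then show ?case
    using D L by (simp add: linear_space_def linear_expectation_def)
next
  case (insert i I)
  have Ui: "U i \<in> D" and cU: "(\<lambda>\<omega>. c i * U i \<omega>) \<in> D"
    using D insert.prems by (auto simp: linear_space_def)
  have IH: "(\<lambda>\<omega>. \<Sum>i\<in>I. c i * U i \<omega>) \<in> D"
    "L (\<lambda>\<omega>. \<Sum>i\<in>I. c i * U i \<omega>) = (\<Sum>i\<in>I. c i * L (U i))"
    using insert by auto
  have "L (\<lambda>\<omega>. c i * U i \<omega> + (\<Sum>i\<in>I. c i * U i \<omega>)) = c i * L (U i) + (\<Sum>i\<in>I. c i * L (U i))"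
    using L Ui cU IH by (simp add: linear_expectation_def)
  moreover have "(\<lambda>\<omega>. c i * U i \<omega> + (\<Sum>i\<in>I. c i * U i \<omega>)) \<in> D"
    using D cU IH(1) by (simp add: linear_space_def)
  ultimately show ?case
    using insert.hyps by simp
qed

text \<open>
  Each coordinate of \<open>x\<close> is a function of \<open>x\<close> times the constant \<open>1\<close>, so it is pulled out of a
  conditional expectation; linearity does the rest.
\<close>

lemma cond_linear_expectation_inner_covariate:
  fixes x :: "'w \<Rightarrow> real ^ 'p"
  assumes D: "linear_space D" and one: "(\<lambda>_. 1) \<in> D"
    and xD: "\<And>i. (\<lambda>\<omega>. x \<omega> $ i) \<in> D"
    and L: "cond_linear_expectation D x \<xi> L"
  shows "(\<lambda>\<omega>. \<beta> \<bullet> x \<omega>) \<in> D" "L (\<lambda>\<omega>. \<beta> \<bullet> x \<omega>) = \<beta> \<bullet> \<xi>"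
proof -
  have lin: "linear_expectation D L"
    using L by (simp add: cond_linear_expectation_def)
  have coord: "L (\<lambda>\<omega>. x \<omega> $ i) = \<xi> $ i" for i
  proof -
    have pull: "L (\<lambda>\<omega>. g (x \<omega>) * U \<omega>) = g \<xi> * L U"
      if "g \<in> borel_measurable borel" "U \<in> D" "(\<lambda>\<omega>. g (x \<omega>) * U \<omega>) \<in> D" for g U
      using L that by (simp add: cond_linear_expectation_def)
    have "(\<lambda>\<zeta>. \<zeta> $ i) \<in> borel_measurable (borel :: (real ^ 'p) measure)"
      by measurable
    from pull[OF this one] show ?thesis
      using xD lin by (simp add: linear_expectation_def)
  qed
  have "(\<lambda>\<omega>. \<beta> \<bullet> x \<omega>) = (\<lambda>\<omega>. \<Sum>i\<in>UNIV. \<beta> $ i * x \<omega> $ i)"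
    by (simp add: inner_vec_def)
  with linear_expectation_sum_scaled[OF D lin, of UNIV "\<lambda>i \<omega>. x \<omega> $ i" "\<lambda>i. \<beta> $ i"] xD
  show "(\<lambda>\<omega>. \<beta> \<bullet> x \<omega>) \<in> D" "L (\<lambda>\<omega>. \<beta> \<bullet> x \<omega>) = \<beta> \<bullet> \<xi>"
    by (simp_all add: coord inner_vec_def)
qed

lemma test_function_scale: "test_function (\<lambda>u::real. c * u)"
  unfolding test_function_def
proof (intro exI allI)
  fix u v :: real
  have "\<bar>c * u - c * v\<bar> = \<bar>c\<bar> * norm (u - v)"
    by (simp add: abs_mult flip: right_diff_distrib)
  also have "\<dots> \<le> \<bar>c\<bar> * (1 + norm u ^ 0 + norm v ^ 0) * norm (u - v)"
    by (intro mult_right_mono) auto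
  finally show "\<bar>c * u - c * v\<bar> \<le> \<bar>c\<bar> * (1 + norm u ^ 0 + norm v ^ 0) * norm (u - v)" .
qed

text \<open>
  Independence, tested on \<open>\<phi> u = u\<close> and \<open>\<phi> u = - u\<close>, bounds \<open>L X\<close> from above and from below by
  the unconditional upper and lower means of \<open>X\<close>, which coincide.
\<close>

lemma certain_zero_mean_under_conditioning:
  assumes fam: "cond_expectation_family H D x \<F>"
    and indep: "independent_of_covariate H E \<F> x X"
    and XH: "X \<in> H"
    and mean: "E X = 0" "E (\<lambda>\<omega>. - X \<omega>) = 0"
    and L: "L \<in> \<F> (x \<omega>)"
  shows "L X = 0"
proof -
  have D: "linear_space D" and XD: "X \<in> D"
    and lin: "linear_expectation D L"
    and bdd: "\<And>U. U \<in> D \<Longrightarrow> bdd_above ((\<lambda>L. L U) ` \<F> (x \<omega>))"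
    using fam L XH
    by (auto simp: cond_expectation_family_def cond_linear_expectation_def)
  have upper: "L (\<lambda>\<omega>. c * X \<omega>) \<le> E (\<lambda>\<omega>. c * X \<omega>)" for c
  proof -
    have "(\<lambda>\<omega>. c * X \<omega>) \<in> D"
      using D XD by (simp add: linear_space_def)
    then have "L (\<lambda>\<omega>. c * X \<omega>) \<le> cond_sublinear_expectation \<F> x (\<lambda>\<omega>. c * X \<omega>) \<omega>"
      unfolding cond_sublinear_expectation_def by (intro cSUP_upper L bdd)
    also have "\<dots> = E (\<lambda>\<omega>. c * X \<omega>)"
      using indep test_function_scale[of c] by (simp add: independent_of_covariate_def)
    finally show ?thesis .
  qed
  have "L (\<lambda>\<omega>. c * X \<omega>) = c * L X" for c
    using lin XD by (simp add: linear_expectation_def)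
  from this[of "-1"] upper[of 1] upper[of "-1"] mean show ?thesis
    by simp
qed

lemma cond_sublinear_expectation_linear_model:
  fixes x :: "'w \<Rightarrow> real ^ 'p"
  assumes H: "sublinear_expectation_space H E"
    and fam: "cond_expectation_family H D x \<F>"
    and indep: "independent_of_covariate H E \<F> x X"
    and XH: "X \<in> H"
    and mean: "E X = 0" "E (\<lambda>\<omega>. - X \<omega>) = 0"
  shows "cond_sublinear_expectation \<F> x (\<lambda>\<omega>. \<beta> \<bullet> x \<omega> + X \<omega>) \<omega> = \<beta> \<bullet> x \<omega>"
proof -
  have "(\<lambda>_. 1) \<in> H"
    using H by (simp add: sublinear_expectation_space_def)
  then have D: "linear_space D" and D_mem: "(\<lambda>_. 1) \<in> D" "X \<in> D" "\<And>i. (\<lambda>\<omega>. x \<omega> $ i) \<in> D"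
    and ne: "\<F> (x \<omega>) \<noteq> {}"
    using fam XH by (auto simp: cond_expectation_family_def)
  have "L (\<lambda>\<omega>. \<beta> \<bullet> x \<omega> + X \<omega>) = \<beta> \<bullet> x \<omega>" if L: "L \<in> \<F> (x \<omega>)" for L
  proof -
    have cond: "cond_linear_expectation D x (x \<omega>) L"
      using fam L by (auto simp: cond_expectation_family_def)
    note covariate = cond_linear_expectation_inner_covariate[OF D D_mem(1,3) cond, of \<beta>]
    have "L (\<lambda>\<omega>. \<beta> \<bullet> x \<omega> + X \<omega>) = L (\<lambda>\<omega>. \<beta> \<bullet> x \<omega>) + L X"
      using cond covariate(1) D_mem(2)
      by (simp add: cond_linear_expectation_def linear_expectation_def)
    then show ?thesis
      using covariate(2) certain_zero_mean_under_conditioning[OF fam indep XH mean L] by simp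
  qed
  then have "(SUP L\<in>\<F> (x \<omega>). L (\<lambda>\<omega>. \<beta> \<bullet> x \<omega> + X \<omega>)) = (SUP L\<in>\<F> (x \<omega>). \<beta> \<bullet> x \<omega>)"
    by (intro SUP_cong) simp_all
  then show ?thesis
    using ne by (simp add: cond_sublinear_expectation_def)
qed

lemma positive_definite_imp_invertible:
  fixes A :: "real ^ 'n ^ 'n"
  assumes "positive_definite A"
  shows "invertible A"
proof -
  have "v = 0" if "A *v v = 0" for v
    using assms that by (force simp: positive_definite_def)
  then show ?thesis
    by (simp add: invertible_left_inverse matrix_left_invertible_ker)
qed

lemma matrix_inv_mult_left:
  fixes A :: "'a::semiring_1 ^ 'n ^ 'm"
  assumes "invertible A"
  shows "matrix_inv A ** A = mat 1"
  using someI_ex[OF assms[unfolded invertible_def]] by (simp add: matrix_inv_def)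

text \<open>
  The population normal equations \<open>E[x x'] \<beta> = E[x (\<beta> \<bullet> x)]\<close>.  Both claims are read off
  coordinatewise, where \<open>(\<beta> \<bullet> x) x\<^sub>i\<close> is a linear combination of the products \<open>x\<^sub>i x\<^sub>j\<close>.
\<close>

lemma second_moment_matrix_mult_vec:
  fixes x :: "'w \<Rightarrow> real ^ 'p"
  assumes int: "\<And>i j. integrable P (\<lambda>\<omega>. x \<omega> $ i * x \<omega> $ j)"
  shows "integrable P (\<lambda>\<omega>. (\<beta> \<bullet> x \<omega>) *\<^sub>R x \<omega>)"
    and "second_moment_matrix P x *v \<beta> = (\<integral>\<omega>. (\<beta> \<bullet> x \<omega>) *\<^sub>R x \<omega> \<partial>P)"
proof -
  let ?f = "\<lambda>\<omega>. (\<beta> \<bullet> x \<omega>) *\<^sub>R x \<omega>"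
  have coord: "?f \<omega> $ i = (\<Sum>j\<in>UNIV. x \<omega> $ i * x \<omega> $ j * \<beta> $ j)" for \<omega> i
    by (simp add: inner_vec_def sum_distrib_left sum_distrib_right mult_ac)
  have int_coord: "integrable P (\<lambda>\<omega>. ?f \<omega> $ i)" for i
    unfolding coord by (intro Bochner_Integration.integrable_sum integrable_mult_left int)
  have "?f = (\<lambda>\<omega>. \<Sum>i\<in>UNIV. ?f \<omega> $ i *\<^sub>R axis i 1)"
    by (simp only: basis_expansion flip: scalar_mult_eq_scaleR)
  moreover have "integrable P (\<lambda>\<omega>. \<Sum>i\<in>UNIV. ?f \<omega> $ i *\<^sub>R axis i (1::real))"
    by (intro Bochner_Integration.integrable_sum integrable_scaleR_left int_coord)
  ultimately show f: "integrable P ?f"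
    by simp
  show "second_moment_matrix P x *v \<beta> = (\<integral>\<omega>. ?f \<omega> \<partial>P)"
  proof (rule vec_eq_iff[THEN iffD2], rule allI)
    fix i
    have "(\<integral>\<omega>. ?f \<omega> \<partial>P) $ i = (\<integral>\<omega>. ?f \<omega> $ i \<partial>P)"
      using integral_bounded_linear[OF bounded_linear_vec_nth f] by simp
    also have "\<dots> = (\<Sum>j\<in>UNIV. (\<integral>\<omega>. x \<omega> $ i * x \<omega> $ j \<partial>P) * \<beta> $ j)"
      unfolding coord using int by (simp add: Bochner_Integration.integral_sum)
    finally show "(second_moment_matrix P x *v \<beta>) $ i = (\<integral>\<omega>. ?f \<omega> \<partial>P) $ i"
      by (simp add: second_moment_matrix_def matrix_vector_mult_def)
  qed
qed

theorem proposition2p1: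
  fixes H D :: "('w \<Rightarrow> real) set"
    and E :: "('w \<Rightarrow> real) \<Rightarrow> real"
    and P :: "'w measure"
    and F :: "(real ^ 'p) measure"
    and \<F> :: "real ^ 'p \<Rightarrow> (('w \<Rightarrow> real) \<Rightarrow> real) set"
    and x :: "'w \<Rightarrow> real ^ 'p"
    and \<epsilon> Y :: "'w \<Rightarrow> real"
    and \<beta> :: "real ^ 'p"
    and sl su :: real
  assumes "sublinear_expectation_space H E"
    and "\<forall>a b c. (\<lambda>\<omega>. a + b * \<epsilon> \<omega> + c * (\<epsilon> \<omega>)\<^sup>2) \<in> H"
    and "certain_distribution H E P x F"
    and "cond_expectation_family H D x \<F>"
    and "independent_of_covariate H E \<F> x \<epsilon>"
    and "G_normal_dist H E \<epsilon> sl su"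
    and "Y = (\<lambda>\<omega>. \<beta> \<bullet> x \<omega> + \<epsilon> \<omega>)"
  shows "(\<forall>\<omega>. cond_sublinear_expectation \<F> x Y \<omega> = \<beta> \<bullet> x \<omega>)
    \<and> ((\<forall>i j. integrable P (\<lambda>\<omega>. x \<omega> $ i * x \<omega> $ j))
         \<and> positive_definite (second_moment_matrix P x)
       \<longrightarrow> invertible (second_moment_matrix P x)
         \<and> integrable P (\<lambda>\<omega>. cond_sublinear_expectation \<F> x Y \<omega> *\<^sub>R x \<omega>)
         \<and> \<beta> = matrix_inv (second_moment_matrix P x)
               *v (\<integral>\<omega>. cond_sublinear_expectation \<F> x Y \<omega> *\<^sub>R x \<omega> \<partial>P))"
proof -
  have "(\<lambda>\<omega>. 0 + 1 * \<epsilon> \<omega> + 0 * (\<epsilon> \<omega>)\<^sup>2) \<in> H"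
    using assms(2) by blast
  then have "\<epsilon> \<in> H"
    by simp
  moreover have "E \<epsilon> = 0" "E (\<lambda>\<omega>. - \<epsilon> \<omega>) = 0"
    using assms(6) by (simp_all add: G_normal_dist_def)
  ultimately have mean: "cond_sublinear_expectation \<F> x Y \<omega> = \<beta> \<bullet> x \<omega>" for \<omega>
    unfolding assms(7)
    using cond_sublinear_expectation_linear_model[OF assms(1,4,5)] by blast
  let ?M = "second_moment_matrix P x"
  have "invertible ?M \<and> integrable P (\<lambda>\<omega>. (\<beta> \<bullet> x \<omega>) *\<^sub>R x \<omega>)
      \<and> \<beta> = matrix_inv ?M *v (\<integral>\<omega>. (\<beta> \<bullet> x \<omega>) *\<^sub>R x \<omega> \<partial>P)"
    if int: "\<forall>i j. integrable P (\<lambda>\<omega>. x \<omega> $ i * x \<omega> $ j)" and pd: "positive_definite ?M"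
  proof -
    have inv: "invertible ?M"
      using pd by (rule positive_definite_imp_invertible)
    then have "matrix_inv ?M *v (?M *v \<beta>) = \<beta>"
      by (simp add: matrix_vector_mul_assoc matrix_inv_mult_left)
    then show ?thesis
      using inv int second_moment_matrix_mult_vec[of P x \<beta>] by simp
  qed
  then show ?thesis
    by (simp add: mean)
qed

end
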